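(* Let $\mathcal{V}$ be a finite dimensional vector space and $T:\mathcal{V}\to\mathcal{V}$ be a linear operator. Then there are Halmos dilations of $T$ which are not similar.
   Context: For a vector space $\mathcal{V}$ and a linear operator $T:\mathcal{V}\to\mathcal{V}$, a Halmos dilation of $T$ is any invertible operator on $\mathcal{V}\oplus\mathcal{V}$ of the block form $\begin{pmatrix} T & B\\ C & D\end{pmatrix}$, i.e. $(x,y)\mapsto (Tx+By,\,Cx+Dy)$, where $B,C,D:\mathcal{V}\to\mathcal{V}$ are linear operators. Two operators $U_1,U_2$ on $\mathcal{V}\oplus\mathcal{V}$ are similar if there is an invertible linear operator $X$ on $\mathcal{V}\oplus\mathcal{V}$ with $U_2=XU_1X^{-1}$.
   Formalization: The vector space V is assumed to be nonzero; for V = {0} the claim is false, since V ⊕ V = {0} carries only one operator, which is similar to itself. *)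

theory Defs
  imports "HOL-Analysis.Product_Vector"
begin

text \<open>A vector space over an arbitrary field is a type together with a scalar multiplication
  \<open>s\<close> satisfying \<^const>\<open>vector_space\<close>. The direct sum of two copies of it is the product type
  with the scalar multiplication \<open>module_prod.scale s s\<close>.\<close>

definition invertible_operator ::
    "('a::field \<Rightarrow> 'v::ab_group_add \<Rightarrow> 'v) \<Rightarrow> ('v \<Rightarrow> 'v) \<Rightarrow> bool"
  where "invertible_operator s U \<longleftrightarrow>
    Vector_Spaces.linear s s U \<and>
    (\<exists>W. Vector_Spaces.linear s s W \<and> W \<circ> U = id \<and> U \<circ> W = id)"

definition block_operator ::
    "('v::ab_group_add \<Rightarrow> 'v) \<Rightarrow> ('v \<Rightarrow> 'v) \<Rightarrow> ('v \<Rightarrow> 'v) \<Rightarrow> ('v \<Rightarrow> 'v) \<Rightarrow> 'v \<times> 'v \<Rightarrow> 'v \<times> 'v"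
  where "block_operator A B C D = (\<lambda>(x, y). (A x + B y, C x + D y))"

definition halmos_dilation ::
    "('a::field \<Rightarrow> 'v::ab_group_add \<Rightarrow> 'v) \<Rightarrow> ('v \<Rightarrow> 'v) \<Rightarrow> ('v \<times> 'v \<Rightarrow> 'v \<times> 'v) \<Rightarrow> bool"
  where "halmos_dilation s T U \<longleftrightarrow>
    invertible_operator (module_prod.scale s s) U \<and>
    (\<exists>B C D. Vector_Spaces.linear s s B \<and> Vector_Spaces.linear s s C \<and>
       Vector_Spaces.linear s s D \<and> U = block_operator T B C D)"

definition similar_operators ::
    "('a::field \<Rightarrow> 'v::ab_group_add \<Rightarrow> 'v) \<Rightarrow> ('v \<Rightarrow> 'v) \<Rightarrow> ('v \<Rightarrow> 'v) \<Rightarrow> bool"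
  where "similar_operators s U1 U2 \<longleftrightarrow>
    (\<exists>X. invertible_operator s X \<and> U2 = X \<circ> U1 \<circ> inv X)"

end

theory Submission
  imports Defs
begin

text \<open>For every operator \<open>D\<close>, composing \<open>(x, y) \<mapsto> (T x + y, x)\<close> with the shear
  \<open>(u, v) \<mapsto> (u, v + D u)\<close> gives a Halmos dilation of \<open>T\<close>, whose fixed vectors
  are the \<open>(x, x - T x)\<close> with \<open>(D + T) x = 0\<close>. So there are nonzero fixed vectors for
  \<open>D = - T\<close> but none for \<open>D = 1 - T\<close>, while similar operators have isomorphic fixed spaces.\<close>

lemma linear_block_operator:
  fixes s :: "'a::field \<Rightarrow> 'v::ab_group_add \<Rightarrow> 'v"
  assumes "Vector_Spaces.linear s s A" "Vector_Spaces.linear s s B"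
    and "Vector_Spaces.linear s s C" "Vector_Spaces.linear s s D"
  shows "Vector_Spaces.linear (module_prod.scale s s) (module_prod.scale s s) (block_operator A B C D)"
proof -
  interpret A: Vector_Spaces.linear s s A by fact
  interpret B: Vector_Spaces.linear s s B by fact
  interpret C: Vector_Spaces.linear s s C by fact
  interpret D: Vector_Spaces.linear s s D by fact
  interpret P: vector_space_prod s s ..
  show ?thesis
    by unfold_locales
      (auto simp: block_operator_def P.scale_def A.add B.add C.add D.add
        A.scale B.scale C.scale D.scale A.vs1.scale_right_distrib algebra_simps split: prod.splits)
qed

text \<open>The lower left entry is forced by the shear: with u = T x + y and v = x, the sum v + D u
  has x-part x + D (T x) and y-part D y.\<close>

lemma halmos_dilation_shear:
  fixes s :: "'a::field \<Rightarrow> 'v::ab_group_add \<Rightarrow> 'v"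
  assumes T: "Vector_Spaces.linear s s T" and D: "Vector_Spaces.linear s s D"
  shows "halmos_dilation s T (block_operator T id (\<lambda>x. x + D (T x)) D)"
proof -
  interpret T: Vector_Spaces.linear s s T by fact
  interpret D: Vector_Spaces.linear s s D by fact
  interpret V: vector_space_pair s s ..
  have DT: "Vector_Spaces.linear s s (\<lambda>x. D (T x))"
    using Vector_Spaces.linear_compose[OF T D] by (simp add: comp_def)
  have TD: "Vector_Spaces.linear s s (\<lambda>x. T (D x))"
    using Vector_Spaces.linear_compose[OF D T] by (simp add: comp_def)
  note id = T.vs1.linear_id
  have C: "Vector_Spaces.linear s s (\<lambda>x. x + D (T x))"
    by (rule V.linear_compose_add[OF T.vs1.linear_ident DT])
  \<comment> \<open>Undo the two factors in reverse order: first (u, v) \<mapsto> (u, v - D u), then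
    (u, v) \<mapsto> (v, u - T v).\<close>
  define W where "W = block_operator (\<lambda>u. - D u) id (\<lambda>u. u + T (D u)) (\<lambda>v. - T v)"
  have "Vector_Spaces.linear (module_prod.scale s s) (module_prod.scale s s) W"
    unfolding W_def
    by (intro linear_block_operator V.linear_compose_neg V.linear_compose_add T D TD id T.vs1.linear_ident)
  moreover have "W \<circ> block_operator T id (\<lambda>x. x + D (T x)) D = id"
    and "block_operator T id (\<lambda>x. x + D (T x)) D \<circ> W = id"
    by (auto simp: W_def block_operator_def fun_eq_iff T.add D.add T.diff D.diff algebra_simps)
  ultimately show ?thesis
    unfolding halmos_dilation_def invertible_operator_def
    using linear_block_operator[OF T id C D] id C D by blast
qed

text \<open>The similarity X carries fixed vectors of \<open>U1\<close> to fixed vectors of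
  \<open>U2\<close>, and being injective it keeps them nonzero.\<close>

lemma similar_operators_fixed_vector:
  assumes "similar_operators s U1 U2" and "U1 v = v" and "v \<noteq> 0"
  shows "\<exists>w. w \<noteq> 0 \<and> U2 w = w"
proof -
  obtain X W where X: "Vector_Spaces.linear s s X" "W \<circ> X = id" "U2 = X \<circ> U1 \<circ> inv X"
    using assms(1) unfolding similar_operators_def invertible_operator_def by blast
  interpret X: Vector_Spaces.linear s s X by fact
  \<comment> \<open>Injectivity is also what makes the choice-based \<open>inv X\<close> cancel X in
    \<open>inv X (X v)\<close>.\<close>
  have "inj X"
    using X(2) by (metis inj_on_id inj_on_imageI2)
  then have "X v \<noteq> 0"
    using assms(3) X.zero by (metis injD)
  moreover have "U2 (X v) = X v"
    using X(3) \<open>inj X\<close> assms(2) by simp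
  ultimately show ?thesis by blast
qed

theorem theorem2p6:
  fixes s :: "'a::field \<Rightarrow> 'v::ab_group_add \<Rightarrow> 'v"
    and Basis :: "'v set"
    and T :: "'v \<Rightarrow> 'v"
  assumes "finite_dimensional_vector_space s Basis"
    and "\<exists>v::'v. v \<noteq> 0"
    and "Vector_Spaces.linear s s T"
  shows "\<exists>U1 U2. halmos_dilation s T U1 \<and> halmos_dilation s T U2 \<and>
    \<not> similar_operators (module_prod.scale s s) U1 U2"
proof -
  obtain v :: 'v where "v \<noteq> 0" using assms(2) by blast
  interpret T: Vector_Spaces.linear s s T by fact
  interpret V: vector_space_pair s s ..
  define U where "U D = block_operator T id (\<lambda>x. x + D (T x)) D" for D
  have "halmos_dilation s T (U (\<lambda>x. - T x))"
    unfolding U_def by (intro halmos_dilation_shear V.linear_compose_neg assms(3))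
  moreover have "halmos_dilation s T (U (\<lambda>x. x - T x))"
    unfolding U_def
    by (intro halmos_dilation_shear V.linear_compose_sub T.vs1.linear_ident assms(3))
  moreover have "\<not> similar_operators (module_prod.scale s s) (U (\<lambda>x. - T x)) (U (\<lambda>x. x - T x))"
  proof
    assume sim: "similar_operators (module_prod.scale s s) (U (\<lambda>x. - T x)) (U (\<lambda>x. x - T x))"
    \<comment> \<open>In the second coordinate, v - T (T v) from the lower left entry and - T v + T
      (T v) from the lower right one add up to v - T v.\<close>
    have "U (\<lambda>x. - T x) (v, v - T v) = (v, v - T v)"
      by (simp add: U_def block_operator_def T.diff)
    moreover have "(v, v - T v) \<noteq> 0"
      using \<open>v \<noteq> 0\<close> by (simp add: zero_prod_def)
    ultimately obtain w where "w \<noteq> 0" "U (\<lambda>x. x - T x) w = w"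
      using similar_operators_fixed_vector[OF sim] by blast
    then obtain x y where xy: "(x, y) \<noteq> 0" "T x + y = x" "x + (T x - T (T x)) + (y - T y) = y"
      by (cases w) (auto simp: U_def block_operator_def)
    have y: "y = x - T x" using xy(2) by (simp add: algebra_simps)
    \<comment> \<open>After substituting for y and cancelling it from both sides, all terms with T
      cancel and only x = 0 remains.\<close>
    have "x = 0" using xy(3) unfolding y by (simp add: T.diff algebra_simps)
    then show False using xy(1) y by (simp add: zero_prod_def T.zero)
  qed
  ultimately show ?thesis by blast
qed

end
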